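(* Let $B\subset\mathbb{R}^2$ be bounded and measurable, let $b_0>0$, $S=(0,b_0]\times[0,\pi)$ and $Y=B\times S$. Let $X$ be the segment process on $Y$ having a hereditary density $$p(\mathbf{x})=c\,\tau^{n(\mathbf{x})}\prod_{u=(y,r,\varphi)\in\mathbf{x}}g(r,\varphi)\,\exp\big(bD(\mathbf{x})+aE(\mathbf{x})\big),\quad \mathbf{x}\in\mathbf{N},$$ with respect to the Poisson process $\eta$ (all objects as defined in the context). Let $\rho$ be the intensity function of $X$, and let $f_X^{(y)}$ be the density of the Palm mark distribution of length and direction of a typical segment of $X$ at the location $y\in B$. Then for each $y\in B$ we have $$f_X^{(y)}(\xi)=\frac{\rho(y,\xi)}{\int_S\rho(y,\zeta)\,\mathrm{d}\zeta},\qquad \xi\in S.$$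
   Context: A segment in $\mathbb{R}^2$ is parametrized by $u=(y,r,\varphi)$: centre $y\in\mathbb{R}^2$, length $r>0$, axial direction $\varphi\in[0,\pi)$. The mark of the segment is $\xi=(r,\varphi)\in S$, so that $b_0$ is an upper bound for the segment length. $\mathbf{N}$ is the space of integer-valued finite measures on $Y$, identified with finite configurations $\mathbf{x}$ of points of $Y$ and equipped with the smallest $\sigma$-algebra making the mappings $\mathbf{x}\mapsto\mathbf{x}(A)$ measurable for all Borel $A\subset Y$. $\eta$ is the Poisson process on $Y$ with intensity measure $\lambda(\mathrm{d}(y,r,\varphi))=\frac{1}{b_0\pi}\,\mathrm{d}y\,\mathrm{d}r\,\mathrm{d}\varphi$ and distribution $P_\eta$. That $X$ has density $p$ with respect to $\eta$ means that its distribution is $P_X(\mathrm{d}\mathbf{x})=p(\mathbf{x})\,P_\eta(\mathrm{d}\mathbf{x})$, where $p\ge 0$ is measurable and $\int p\,\mathrm{d}P_\eta=1$. Hereditary means: $p(\mathbf{x})>0$ and $\mathbf{x}'\subset\mathbf{x}$ imply $p(\mathbf{x}')>0$. In the formula for $p$: $c>0$ is a normalizing constant; $b\in\mathbb{R}$, $a\le 0$ and $\tau>0$ are parameters; $g$ is the density of the reference length-direction distribution; $n(\mathbf{x})$ is the number of segments in $\mathbf{x}$; $D(\mathbf{x})=\sum_{u\in\mathbf{x}}d(u)$; and $E(\mathbf{x})=\sum^{\neq}_{\{u,v\}\subset\mathbf{x}}\Phi(u,v)$ (sum over pairs of different segments of $\mathbf{x}$), for some nonnegative functions $d$ on $Y$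 and $\Phi$ on $Y^2$. The intensity function $\rho$ of $X$ is defined by $\mathbb{E}X(A)=\int_A\rho(u)\,\mathrm{d}u$ for $A\subset Y$. For measurable $A\subset B$ put $\kappa(A)=\mathbb{E}\sum_{y\in\nu}1_A(y)$, where $\nu$ is the point process of segment centres of $X$. For $D'\subset S$ put $C(A\times D')=\mathbb{E}\sum_{(y,\xi)\in X}1_A(y)1_{D'}(\xi)$. The measure $\omega_{D'}(A)=C(A\times D')$ is absolutely continuous with respect to $\kappa$, and its Radon-Nikodym density $P^y(D')$, satisfying $\omega_{D'}(A)=\int_A P^y(D')\,\kappa(\mathrm{d}y)$, is the Palm mark distribution of $X$ at $y$. $f_X^{(y)}$ is the density of $P^y$ on $S$ with respect to $\mathrm{d}\xi=\mathrm{d}r\,\mathrm{d}\varphi$.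
   Formalization: The identity is stated for κ-almost every y in B and almost every ξ in S, for arbitrary versions of ρ and the Palm mark distribution, instead of for each y and ξ, since these objects are determined only up to null sets. *)

theory Defs
  imports "HOL-Probability.Probability"
begin

section \<open>Finite point processes\<close>

text \<open>
  An integer-valued finite measure on a Borel space is a finite sum of Dirac measures, that is, a
  finite multiset of points \<open>x\<close>; its value on \<open>A\<close> is the number of points of \<open>x\<close> in \<open>A\<close>, counted
  with multiplicity.
\<close>

definition points_in :: "'a multiset \<Rightarrow> 'a set \<Rightarrow> nat" where
  "points_in x A = size {#u \<in># x. u \<in> A#}"

definition config_space :: "'a measure \<Rightarrow> 'a multiset measure" where
  "config_space E =
    (SUP A \<in> sets E. vimage_algebra {x. set_mset x \<subseteq> space E} (\<lambda>x. points_in x A) (count_space UNIV))"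

text \<open>
  Only for a finite intensity measure \<open>\<Lambda>\<close>, since configurations are finite. The formula for the
  one-dimensional distributions includes the case \<open>measure \<Lambda> A = 0\<close>, as \<open>0 ^ 0 = 1\<close>.
\<close>

definition poisson_process :: "'w measure \<Rightarrow> ('w \<Rightarrow> 'a multiset) \<Rightarrow> 'a measure \<Rightarrow> bool" where
  "poisson_process M \<eta> \<Lambda> \<longleftrightarrow>
    prob_space M \<and> finite_measure \<Lambda> \<and> \<eta> \<in> M \<rightarrow>\<^sub>M config_space \<Lambda> \<and>
    (\<forall>A \<in> sets \<Lambda>. \<forall>k. measure M {w \<in> space M. points_in (\<eta> w) A = k} =
        measure \<Lambda> A ^ k / fact k * exp (- measure \<Lambda> A)) \<and>
    (\<forall>F. finite F \<longrightarrow> F \<subseteq> sets \<Lambda> \<longrightarrow> disjoint F \<longrightarrow>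
        prob_space.indep_vars M (\<lambda>_. count_space UNIV) (\<lambda>A w. points_in (\<eta> w) A) F)"

definition has_process_density ::
  "'w measure \<Rightarrow> ('w \<Rightarrow> 'a multiset) \<Rightarrow> 'a measure \<Rightarrow> 'a multiset measure \<Rightarrow> ('a multiset \<Rightarrow> real) \<Rightarrow> bool" where
  "has_process_density M X E P\<^sub>\<eta> p \<longleftrightarrow>
    X \<in> M \<rightarrow>\<^sub>M config_space E \<and>
    p \<in> borel_measurable (config_space E) \<and>
    (\<forall>x \<in> space (config_space E). 0 \<le> p x) \<and>
    (\<integral>\<^sup>+x. ennreal (p x) \<partial>P\<^sub>\<eta>) = 1 \<and>
    distr M (config_space E) X = density P\<^sub>\<eta> (\<lambda>x. ennreal (p x))"

definition hereditary :: "'a measure \<Rightarrow> ('a multiset \<Rightarrow> real) \<Rightarrow> bool" where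
  "hereditary E p \<longleftrightarrow>
    (\<forall>x \<in> space (config_space E). \<forall>x'. x' \<subseteq># x \<longrightarrow> p x > 0 \<longrightarrow> p x' > 0)"

definition mean_measure :: "'w measure \<Rightarrow> ('w \<Rightarrow> 'a multiset) \<Rightarrow> 'a measure \<Rightarrow> 'a measure" where
  "mean_measure M X E =
    measure_of (space E) (sets E) (\<lambda>A. \<integral>\<^sup>+w. of_nat (points_in (X w) A) \<partial>M)"

text \<open>
  Unordered pairs are represented by halving the sum over ordered pairs; for symmetric \<open>\<Phi>\<close>
  this is the sum over \<open>{u, v} \<subseteq> x\<close> with \<open>u \<noteq> v\<close>.
\<close>

definition pair_sum :: "('a \<Rightarrow> 'a \<Rightarrow> real) \<Rightarrow> 'a multiset \<Rightarrow> real" where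
  "pair_sum \<Phi> x = (\<Sum>u\<in>#x. \<Sum>v\<in>#{#v \<in># x. v \<noteq> u#}. \<Phi> u v) / 2"

section \<open>Segment processes\<close>

type_synonym mark = "real \<times> real"

text \<open>A segment is a triple \<open>(y, r, \<phi>)\<close>; nesting of pairs makes this the centre \<open>y\<close> paired with
  the mark \<open>(r, \<phi>)\<close>.\<close>

type_synonym segment = "(real^2) \<times> mark"

definition mark_set :: "real \<Rightarrow> mark set" where
  "mark_set b\<^sub>0 = {0<..b\<^sub>0} \<times> {0..<pi}"

text \<open>Lebesgue measures \<open>d\<xi>\<close> on \<open>S\<close>, \<open>du\<close> on \<open>Y = B \<times> S\<close>, and the intensity measure of the
  reference Poisson process.\<close>

definition mark_leb :: "real \<Rightarrow> mark measure" where
  "mark_leb b\<^sub>0 = restrict_space lborel (mark_set b\<^sub>0)"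

definition segment_leb :: "(real^2) set \<Rightarrow> real \<Rightarrow> segment measure" where
  "segment_leb B b\<^sub>0 = restrict_space lborel (B \<times> mark_set b\<^sub>0)"

definition reference_measure :: "(real^2) set \<Rightarrow> real \<Rightarrow> segment measure" where
  "reference_measure B b\<^sub>0 = scale_measure (ennreal (1 / (b\<^sub>0 * pi))) (segment_leb B b\<^sub>0)"

definition intensity_function ::
  "'w measure \<Rightarrow> ('w \<Rightarrow> segment multiset) \<Rightarrow> (real^2) set \<Rightarrow> real \<Rightarrow> (segment \<Rightarrow> real) \<Rightarrow> bool" where
  "intensity_function M X B b\<^sub>0 \<rho> \<longleftrightarrow>
    \<rho> \<in> borel_measurable (segment_leb B b\<^sub>0) \<and>
    (\<forall>u \<in> space (segment_leb B b\<^sub>0). 0 \<le> \<rho> u) \<and>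
    (\<forall>A \<in> sets (segment_leb B b\<^sub>0).
        (\<integral>\<^sup>+w. of_nat (points_in (X w) A) \<partial>M) = (\<integral>\<^sup>+u\<in>A. ennreal (\<rho> u) \<partial>segment_leb B b\<^sub>0))"

text \<open>The measure \<open>\<kappa>\<close>: mean number of segment centres.\<close>

definition centre_measure ::
  "'w measure \<Rightarrow> ('w \<Rightarrow> segment multiset) \<Rightarrow> (real^2) set \<Rightarrow> (real^2) measure" where
  "centre_measure M X B =
    mean_measure M (\<lambda>w. image_mset fst (X w)) (restrict_space borel B)"

definition campbell ::
  "'w measure \<Rightarrow> ('w \<Rightarrow> segment multiset) \<Rightarrow> (real^2) set \<Rightarrow> mark set \<Rightarrow> ennreal" where
  "campbell M X A D = (\<integral>\<^sup>+w. (\<Sum>(y, \<xi>)\<in>#X w. indicator A y * indicator D \<xi>) \<partial>M)"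

text \<open>
  \<open>P\<close> is a version of the Palm mark distribution: a probability kernel from \<open>B\<close> to \<open>S\<close> such that,
  for every \<open>D\<close>, \<open>y \<mapsto> P y D\<close> is a Radon--Nikodym density of \<open>A \<mapsto> C (A \<times> D)\<close> with respect to
  \<open>\<kappa>\<close>. Hence \<open>P y\<close> is determined only for \<open>\<kappa>\<close>-almost every \<open>y\<close>.
\<close>

definition palm_mark_distribution ::
  "'w measure \<Rightarrow> ('w \<Rightarrow> segment multiset) \<Rightarrow> (real^2) set \<Rightarrow> real \<Rightarrow> (real^2 \<Rightarrow> mark measure) \<Rightarrow> bool" where
  "palm_mark_distribution M X B b\<^sub>0 P \<longleftrightarrow>
    P \<in> restrict_space borel B \<rightarrow>\<^sub>M prob_algebra (mark_leb b\<^sub>0) \<and>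
    (\<forall>A \<in> sets (restrict_space borel B). \<forall>D \<in> sets (mark_leb b\<^sub>0).
        campbell M X A D = (\<integral>\<^sup>+y\<in>A. emeasure (P y) D \<partial>centre_measure M X B))"

text \<open>
  If \<open>P y\<close> had no density, then \<open>RN_deriv\<close> would be the zero function; equality of
  \<open>mark_density b\<^sub>0 P y\<close> with a function of integral one therefore includes the absolute continuity
  of \<open>P y\<close>.
\<close>

definition mark_density :: "real \<Rightarrow> (real^2 \<Rightarrow> mark measure) \<Rightarrow> real^2 \<Rightarrow> mark \<Rightarrow> ennreal" where
  "mark_density b\<^sub>0 P y = RN_deriv (mark_leb b\<^sub>0) (P y)"

text \<open>On the processes considered, \<open>measure_of\<close> in the definition of \<open>\<kappa>\<close> is applied to a genuine
  measure, so that it does not degenerate to the zero measure.\<close>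

lemma space_config_space: "space (config_space E) = {x. set_mset x \<subseteq> space E}"
  by (auto simp: config_space_def space_Sup_eq_UN)

lemma measurable_points_in:
  assumes "A \<in> sets E"
  shows "(\<lambda>x. points_in x A) \<in> config_space E \<rightarrow>\<^sub>M count_space UNIV"
  unfolding config_space_def
  by (rule measurable_SUP1[OF assms]) (auto intro: measurable_vimage_algebra1)

lemma emeasure_mean_measure:
  assumes "\<And>A. A \<in> sets E \<Longrightarrow> (\<lambda>w. points_in (X w) A) \<in> M \<rightarrow>\<^sub>M count_space UNIV"
    and "A \<in> sets E"
  shows "emeasure (mean_measure M X E) A = (\<integral>\<^sup>+w. of_nat (points_in (X w) A) \<partial>M)"
proof (rule emeasure_measure_of[OF mean_measure_def])
  show "sets E \<subseteq> Pow (space E)" by (rule sets.space_closed)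
  have p: "(of_nat (points_in x A)::ennreal) = emeasure (count_space UNIV) {i. i < size x \<and> (SOME xs. mset xs = x) ! i \<in> A}" for x::"'a multiset" and A
  proof -
    let ?xs = "SOME xs. mset xs = x"
    have 1: "mset ?xs = x" by (rule someI_ex) (rule ex_mset)
    have "points_in x A = length (filter (\<lambda>u. u \<in> A) ?xs)"
      unfolding points_in_def by (subst 1[symmetric]) (metis mset_filter size_mset)
    also have "\<dots> = card {i. i < length ?xs \<and> ?xs ! i \<in> A}" by (rule length_filter_conv_card)
    also have "length ?xs = size x" using 1 by (metis size_mset)
    finally show ?thesis by (simp add: emeasure_count_space_finite)
  qed
  show "countably_additive (sets (mean_measure M X E)) (\<lambda>A. \<integral>\<^sup>+w. of_nat (points_in (X w) A) \<partial>M)"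
  proof (rule countably_additiveI)
    fix F :: "nat \<Rightarrow> 'a set"
    assume F: "range F \<subseteq> sets (mean_measure M X E)" "disjoint_family F"
    then have FE: "F i \<in> sets E" for i unfolding mean_measure_def by auto
    have [measurable]: "(\<lambda>w. (of_nat (points_in (X w) (F i))::ennreal)) \<in> borel_measurable M" for i
      by (rule measurable_compose[OF assms(1)[OF FE]]) simp
    have "(\<Sum>i. of_nat (points_in x (F i))) = (of_nat (points_in x (\<Union>i. F i))::ennreal)" for x
    proof -
      have "{i. i < size x \<and> (SOME xs. mset xs = x) ! i \<in> (\<Union>i. F i)} = (\<Union>k. {i. i < size x \<and> (SOME xs. mset xs = x) ! i \<in> F k})" by auto
      moreover have "disjoint_family (\<lambda>k. {i. i < size x \<and> (SOME xs. mset xs = x) ! i \<in> F k})"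
        using F(2) by (auto simp: disjoint_family_on_def)
      ultimately show ?thesis unfolding p by (subst suminf_emeasure) auto
    qed
    then show "(\<Sum>i. \<integral>\<^sup>+w. of_nat (points_in (X w) (F i)) \<partial>M) = (\<integral>\<^sup>+w. of_nat (points_in (X w) (\<Union>i. F i)) \<partial>M)"
      by (subst nn_integral_suminf[symmetric]) auto
  qed
qed (use assms in \<open>auto simp: positive_def points_in_def mean_measure_def\<close>)

lemma emeasure_centre_measure:
  assumes "X \<in> M \<rightarrow>\<^sub>M config_space (segment_leb B b0)" "B \<in> sets borel" "A \<in> sets (restrict_space borel B)"
  shows "emeasure (centre_measure M X B) A = (\<integral>\<^sup>+w. of_nat (points_in (image_mset fst (X w)) A) \<partial>M)"
  unfolding centre_measure_def
proof (rule emeasure_mean_measure[OF _ assms(3)])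
  fix A assume A: "A \<in> sets (restrict_space borel B)"
  have m: "mark_set b0 \<in> sets borel" unfolding mark_set_def by (intro borel_Times) auto
  have AB: "A \<in> sets borel" "A \<subseteq> B" using A assms(2) by (auto simp: sets_restrict_space_iff)
  have "A \<times> mark_set b0 \<in> sets (segment_leb B b0)"
    unfolding segment_leb_def using AB m assms(2) by (subst sets_restrict_space_iff) (auto intro!: borel_Times)
  from measurable_compose[OF assms(1) measurable_points_in[OF this]]
  show "(\<lambda>w. points_in (image_mset fst (X w)) A) \<in> M \<rightarrow>\<^sub>M count_space UNIV"
  proof (rule measurable_cong[THEN iffD1, rotated])
    fix w assume "w \<in> space M"
    then have "X w \<in> space (config_space (segment_leb B b0))" using assms(1) by (auto dest: measurable_space)
    then have "set_mset (X w) \<subseteq> B \<times> mark_set b0" by (auto simp: space_config_space segment_leb_def space_restrict_space)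
    then show "points_in (X w) (A \<times> mark_set b0) = points_in (image_mset fst (X w)) A"
      unfolding points_in_def filter_mset_image_mset size_image_mset
      by (intro arg_cong[where f=size] filter_mset_cong) auto
  qed
qed

end

theory Submission
  imports Defs
begin

text \<open>
  Write \<open>h y = \<integral> \<rho> (y, \<zeta>) d\<zeta>\<close>. Counting the segments with centre in \<open>A\<close> and mark in \<open>D\<close> gives the
  Campbell measure \<open>C (A \<times> D) = \<integral>\<^sub>A \<integral>\<^sub>D \<rho> (y, \<xi>) d\<xi> dy\<close>, and \<open>D = S\<close> shows that \<open>\<kappa>\<close> has the Lebesgue
  density \<open>h\<close>. On the other hand \<open>C (A \<times> D) = \<integral>\<^sub>A h y * P y D dy\<close> by the definition of the Palm
  mark distribution. Comparing the integrands, \<open>h y * P y D = \<integral>\<^sub>D \<rho> (y, \<xi>) d\<xi>\<close> for almost every \<open>y\<close>,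
  with one exceptional null set for all \<open>D\<close> in a countable generator of the mark
  \<open>\<sigma>\<close>-algebra that is closed under intersections. Where \<open>0 < h y < \<infinity>\<close>, dividing by \<open>h y\<close> identifies
  \<open>P y\<close> with the measure of density \<open>\<rho> (y, \<xi>) / h y\<close>. Lemma \<open>conditional_density\<close> carries out this
  argument.

  The set where \<open>h y = 0\<close> is \<open>\<kappa>\<close>-null, but the bound \<open>h y < \<infinity>\<close> is essential: a finite-valued \<open>\<rho>\<close> with
  \<open>h y = \<infinity>\<close> cannot be normalised, and then \<open>C\<close> need not determine \<open>P y\<close>. The bound follows from the
  finiteness of the mean total number of segments, \<open>\<integral> h y dy\<close>, and this is where the form of the
  density \<open>p\<close> enters. Put \<open>f u = p {#u#} / c\<close>. Since \<open>a \<le> 0\<close> and \<open>\<Phi> \<ge> 0\<close>, the interaction only lowers the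
  density: \<open>p x \<le> c * (\<Prod>u\<in>#x. f u)\<close> (lemma \<open>gibbs_density_le_product\<close>), with equality on configurations of
  a single point. As \<open>p\<close> has integral one, its integral over the one-point configurations is at
  most one, which bounds \<open>\<integral> f d\<Lambda>\<close> (lemma \<open>poisson_one_point_formula\<close>). For a Poisson process
  \<open>\<E> (\<Prod>u\<in>#\<eta>. f u) = exp (\<integral> f d\<Lambda> - \<Lambda> Y)\<close> (lemma \<open>poisson_product_functional\<close>). Together with
  \<open>n \<le> 2 ^ n\<close>, the mean number of points of \<open>X\<close> is at most \<open>c * \<E> (\<Prod>u\<in>#\<eta>. 2 * f u)\<close>, which is finite
  (lemma \<open>finite_mean_number_of_points\<close>).
\<close>

section \<open>Sums and products over the points of a configuration\<close>

lemma points_in_add: "points_in (add_mset u x) A = points_in x A + (if u \<in> A then 1 else 0)"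
  by (simp add: points_in_def)

lemma points_in_empty [simp]: "points_in {#} A = 0"
  by (simp add: points_in_def)

lemma points_in_space:
  assumes "x \<in> space (config_space E)"
  shows "points_in x (space E) = size x"
proof -
  have "{#u \<in># x. u \<in> space E#} = x"
    using assms by (subst filter_mset_eq_conv) (auto simp: space_config_space)
  then show ?thesis by (simp add: points_in_def)
qed

lemma config_space_cong:
  assumes "sets E = sets E'"
  shows "config_space E = config_space E'"
  using assms sets_eq_imp_space_eq[OF assms] by (simp add: config_space_def)

text \<open>
  Through this embedding, a measurable density \<open>p\<close> on configurations gives the measurable weight
  \<open>u \<mapsto> p {#u#}\<close> on points.
\<close>

lemma measurable_singleton_mset: "(\<lambda>u. {#u#}) \<in> E \<rightarrow>\<^sub>M config_space E"
  unfolding config_space_def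
proof (rule measurable_SUP2)
  show "sets E \<noteq> {}" by auto
  fix A assume A: "A \<in> sets E"
  show "(\<lambda>u. {#u#}) \<in> E \<rightarrow>\<^sub>M
    vimage_algebra {x. set_mset x \<subseteq> space E} (\<lambda>x. points_in x A) (count_space UNIV)"
  proof (rule measurable_vimage_algebra2)
    have [measurable]: "A \<in> sets E" by fact
    have "(\<lambda>u. if u \<in> A then 1 else 0 :: nat) \<in> E \<rightarrow>\<^sub>M count_space UNIV"
      by measurable
    then show "(\<lambda>u. points_in {#u#} A) \<in> E \<rightarrow>\<^sub>M count_space UNIV"
      by (simp add: points_in_add)
  qed auto
qed auto

lemma sum_mset_indicator: "(\<Sum>u\<in>#x. indicator A u) = (of_nat (points_in x A) :: ennreal)"
  by (induction x) (auto simp: points_in_add)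

lemma incseq_sum_mset:
  fixes U :: "nat \<Rightarrow> 'a \<Rightarrow> ennreal"
  assumes "incseq U"
  shows "incseq (\<lambda>i. \<Sum>u\<in>#x. U i u)"
  using assms by (induction x) (auto simp: incseq_def le_fun_def intro!: add_mono)

lemma sum_mset_SUP:
  fixes U :: "nat \<Rightarrow> 'a \<Rightarrow> ennreal"
  assumes "incseq U"
  shows "(\<Sum>u\<in>#x. SUP i. U i u) = (SUP i. \<Sum>u\<in>#x. U i u)"
proof (induction x)
  case (add u x)
  have "incseq (\<lambda>i. U i u)" using assms by (auto simp: incseq_def le_fun_def)
  then show ?case
    using add incseq_sum_mset[OF assms, of x] by (simp add: ennreal_SUP_add)
qed (simp add: bot_ennreal)

lemma prod_mset_mono_ennreal:
  fixes f g :: "'a \<Rightarrow> ennreal"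
  assumes "\<And>u. u \<in># x \<Longrightarrow> f u \<le> g u"
  shows "(\<Prod>u\<in>#x. f u) \<le> (\<Prod>u\<in>#x. g u)"
  using assms by (induction x) (auto intro!: mult_mono)

text \<open>
  Finite limits keep the product away from \<open>0 * \<infinity>\<close>, where multiplication is discontinuous; the bound
  on the limit of the product is needed to carry the induction.
\<close>

lemma prod_mset_tendsto_ennreal:
  fixes U :: "nat \<Rightarrow> 'a \<Rightarrow> ennreal"
  assumes "\<And>u. u \<in># x \<Longrightarrow> (\<lambda>i. U i u) \<longlonglongrightarrow> f u" and "\<And>u. u \<in># x \<Longrightarrow> f u < \<top>"
  shows "(\<lambda>i. \<Prod>u\<in>#x. U i u) \<longlonglongrightarrow> (\<Prod>u\<in>#x. f u) \<and> (\<Prod>u\<in>#x. f u) < \<top>"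
  using assms
proof (induction x)
  case (add u x)
  then have "f u < \<top>" "(\<Prod>u\<in>#x. f u) < \<top>" by simp_all
  with add have "(\<lambda>i. U i u * (\<Prod>u\<in>#x. U i u)) \<longlonglongrightarrow> f u * (\<Prod>u\<in>#x. f u)"
    by (intro tendsto_mult_ennreal) (auto simp: less_top)
  with add show ?case by (auto simp: ennreal_mult_less_top)
qed auto

lemma measurable_sum_mset:
  assumes X: "X \<in> M \<rightarrow>\<^sub>M config_space E" and f: "f \<in> borel_measurable E"
  shows "(\<lambda>w. \<Sum>u\<in>#X w. f u :: ennreal) \<in> borel_measurable M"
  using f
proof induction
  case (cong f g)
  have "(\<Sum>u\<in>#X w. f u) = (\<Sum>u\<in>#X w. g u)" if "w \<in> space M" for w
    using measurable_space[OF X that] cong(3)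
    by (intro arg_cong[where f = sum_mset] image_mset_cong) (auto simp: space_config_space)
  then show ?case using cong(4) by (subst measurable_cong[of M _ "\<lambda>w. \<Sum>u\<in>#X w. g u"]) auto
next
  case (set A)
  show ?case unfolding sum_mset_indicator
    by (rule measurable_compose[OF X measurable_compose[OF measurable_points_in[OF set]]]) simp
next
  case (mult u c)
  then show ?case by (simp add: sum_mset_distrib_left[symmetric])
next
  case (add u v)
  then show ?case by (simp add: sum_mset.distrib)
next
  case (seq U)
  then show ?case by (simp add: image_comp sum_mset_SUP)
qed

text \<open>
  Both sides are additive and continuous along increasing sequences in \<open>f\<close>, and for an indicator
  the formula is the definition of the mean measure.
\<close>

lemma campbell_formula:
  assumes X: "X \<in> M \<rightarrow>\<^sub>M config_space E" and f: "f \<in> borel_measurable E"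
  shows "(\<integral>\<^sup>+w. (\<Sum>u\<in>#X w. f u) \<partial>M) = (\<integral>\<^sup>+u. f u \<partial>mean_measure M X E)"
  using f
proof induction
  have sets: "sets (mean_measure M X E) = sets E" and space: "space (mean_measure M X E) = space E"
    by (simp_all add: mean_measure_def sets.space_closed)
  note mm = measurable_cong_sets[OF sets refl]
  {
  case (cong f g)
  have "(\<Sum>u\<in>#X w. f u) = (\<Sum>u\<in>#X w. g u)" if "w \<in> space M" for w
    using measurable_space[OF X that] cong(3)
    by (intro arg_cong[where f = sum_mset] image_mset_cong) (auto simp: space_config_space)
  moreover have "(\<integral>\<^sup>+u. f u \<partial>mean_measure M X E) = (\<integral>\<^sup>+u. g u \<partial>mean_measure M X E)"
    using cong(3) space by (intro nn_integral_cong) simp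
  ultimately show ?case using cong(4)
    by (simp cong: nn_integral_cong)
next
  case (set A)
  have "(\<lambda>w. points_in (X w) A) \<in> M \<rightarrow>\<^sub>M count_space UNIV" if "A \<in> sets E" for A
    by (rule measurable_compose[OF X measurable_points_in[OF that]])
  then show ?case using set sets
    by (simp add: sum_mset_indicator emeasure_mean_measure)
next
  case (mult u c)
  then show ?case using measurable_sum_mset[OF X mult(2)]
    by (simp add: sum_mset_distrib_left[symmetric] nn_integral_cmult mm)
next
  case (add u v)
  then show ?case using measurable_sum_mset[OF X add(1)] measurable_sum_mset[OF X add(3)]
    by (simp add: sum_mset.distrib nn_integral_add mm)
next
  case (seq U)
  have "(\<integral>\<^sup>+w. (\<Sum>u\<in>#X w. (SUP i. U i) u) \<partial>M) = (\<integral>\<^sup>+w. (SUP i. \<Sum>u\<in>#X w. U i u) \<partial>M)"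
    using seq by (simp add: image_comp sum_mset_SUP)
  also have "\<dots> = (SUP i. \<integral>\<^sup>+w. (\<Sum>u\<in>#X w. U i u) \<partial>M)"
    using measurable_sum_mset[OF X seq(1)] incseq_sum_mset[OF seq(3)]
    by (intro nn_integral_monotone_convergence_SUP) (auto simp: incseq_def le_fun_def)
  also have "\<dots> = (SUP i. \<integral>\<^sup>+u. U i u \<partial>mean_measure M X E)"
    using seq by simp
  also have "\<dots> = (\<integral>\<^sup>+u. (SUP i. U i u) \<partial>mean_measure M X E)"
    using seq by (intro nn_integral_monotone_convergence_SUP[symmetric]) (auto simp: mm)
  finally show ?case by (simp add: image_comp)
  }
qed

section \<open>Functionals of a Poisson process\<close>

lemma poisson_process_count:
  assumes "poisson_process Q \<eta> \<Lambda>" and A: "A \<in> sets \<Lambda>"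
  shows "(\<lambda>q. points_in (\<eta> q) A) \<in> Q \<rightarrow>\<^sub>M count_space UNIV"
    and "emeasure Q {q \<in> space Q. points_in (\<eta> q) A = k} =
      ennreal (measure \<Lambda> A ^ k / fact k * exp (- measure \<Lambda> A))"
proof -
  interpret prob_space Q using assms by (simp add: poisson_process_def)
  show "(\<lambda>q. points_in (\<eta> q) A) \<in> Q \<rightarrow>\<^sub>M count_space UNIV"
    using assms by (intro measurable_compose[OF _ measurable_points_in[OF A]]) (simp add: poisson_process_def)
  show "emeasure Q {q \<in> space Q. points_in (\<eta> q) A = k} =
      ennreal (measure \<Lambda> A ^ k / fact k * exp (- measure \<Lambda> A))"
    using assms by (simp add: poisson_process_def emeasure_eq_measure)
qed

lemma poisson_count_generating_function:
  assumes P: "poisson_process Q \<eta> \<Lambda>" and A: "A \<in> sets \<Lambda>" and s: "0 \<le> s"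
  shows "(\<integral>\<^sup>+q. ennreal s ^ points_in (\<eta> q) A \<partial>Q) = ennreal (exp ((s - 1) * measure \<Lambda> A))"
proof -
  let ?m = "measure \<Lambda> A"
  note N = poisson_process_count[OF P A]
  have "(\<integral>\<^sup>+q. ennreal s ^ points_in (\<eta> q) A \<partial>Q) =
      (\<integral>\<^sup>+k. ennreal s ^ k \<partial>distr Q (count_space UNIV) (\<lambda>q. points_in (\<eta> q) A))"
    by (subst nn_integral_distr[OF N(1)]) auto
  also have "distr Q (count_space UNIV) (\<lambda>q. points_in (\<eta> q) A) =
      density (count_space UNIV) (\<lambda>k. ennreal (?m ^ k / fact k * exp (- ?m)))"
  proof (rule measure_eqI_countable[where A = UNIV])
    fix k :: nat
    have "emeasure (distr Q (count_space UNIV) (\<lambda>q. points_in (\<eta> q) A)) {k} =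
        emeasure Q {q \<in> space Q. points_in (\<eta> q) A = k}"
      by (subst emeasure_distr[OF N(1)]) (auto intro!: arg_cong[where f = "emeasure Q"])
    then show "emeasure (distr Q (count_space UNIV) (\<lambda>q. points_in (\<eta> q) A)) {k} =
      emeasure (density (count_space UNIV) (\<lambda>k. ennreal (?m ^ k / fact k * exp (- ?m)))) {k}"
      by (simp add: N(2) emeasure_density)
  qed auto
  also have "(\<integral>\<^sup>+k. ennreal s ^ k \<partial>\<dots>) =
      (\<Sum>k. ennreal (?m ^ k / fact k * exp (- ?m)) * ennreal s ^ k)"
    by (simp add: nn_integral_density nn_integral_count_space_nat)
  also have "\<dots> = (\<Sum>k. ennreal ((s * ?m) ^ k / fact k * exp (- ?m)))"
    using s by (simp add: ennreal_power ennreal_mult[symmetric] power_mult_distrib mult_ac divide_simps)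
  also have "\<dots> = ennreal (exp (s * ?m) * exp (- ?m))"
  proof (rule suminf_ennreal_eq)
    show "(\<lambda>k. (s * ?m) ^ k / fact k * exp (- ?m)) sums (exp (s * ?m) * exp (- ?m))"
      using exp_converges[of "s * ?m"] by (intro sums_mult2) (simp add: divide_inverse mult.commute)
  qed (use s in auto)
  finally show ?thesis by (simp add: exp_add[symmetric] algebra_simps)
qed

text \<open>
  Grouping the points by the value of \<open>f\<close> turns the product over a configuration into a product of
  functions of the counts in disjoint sets, which are independent for a Poisson process.
\<close>

lemma prod_mset_eq_prod_fibres:
  fixes f :: "'a \<Rightarrow> ennreal"
  assumes "finite (f ` S)" and "set_mset x \<subseteq> S"
  shows "(\<Prod>u\<in>#x. f u) = (\<Prod>c\<in>f ` S. c ^ points_in x (f -` {c} \<inter> S))"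
  using assms(2)
proof (induction x)
  case (add u x)
  have "(\<Prod>c\<in>f ` S. c ^ points_in (add_mset u x) (f -` {c} \<inter> S)) =
      (\<Prod>c\<in>f ` S. c ^ points_in x (f -` {c} \<inter> S) * (if c = f u then c else 1))"
    using add by (intro prod.cong) (auto simp: points_in_add mult.commute)
  also have "\<dots> = (\<Prod>c\<in>f ` S. c ^ points_in x (f -` {c} \<inter> S)) * f u"
    using add assms(1) by (simp add: prod.distrib prod.delta)
  finally show ?case using add by (simp add: mult.commute)
qed simp

text \<open>
  For simple \<open>f\<close> the product splits over the finitely many level sets of \<open>f\<close>, and each factor
  contributes the generating function of a Poisson variable.
\<close>

lemma poisson_product_functional_simple:
  fixes f :: "'a \<Rightarrow> ennreal"
  assumes P: "poisson_process Q \<eta> \<Lambda>" and f: "simple_function \<Lambda> f" and fin: "\<And>u. f u < \<top>"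
  shows "(\<integral>\<^sup>+q. (\<Prod>u\<in>#\<eta> q. f u) \<partial>Q) =
    ennreal (exp (enn2real (\<integral>\<^sup>+u. f u \<partial>\<Lambda>) - measure \<Lambda> (space \<Lambda>)))"
    and "(\<integral>\<^sup>+u. f u \<partial>\<Lambda>) < \<top>"
    and "(\<lambda>q. \<Prod>u\<in>#\<eta> q. f u) \<in> borel_measurable Q"
proof -
  interpret Q: prob_space Q using P by (simp add: poisson_process_def)
  interpret L: finite_measure \<Lambda> using P by (simp add: poisson_process_def)
  define R where "R = f ` space \<Lambda>"
  define A where "A c = f -` {c} \<inter> space \<Lambda>" for c
  have R: "finite R" using f by (simp add: R_def simple_function_def)
  have A: "A c \<in> sets \<Lambda>" for c
    unfolding A_def by (rule simple_functionD(2)[OF f])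
  have disj: "disjoint_family_on A R" by (auto simp: disjoint_family_on_def A_def)
  have inj: "inj_on A R" by (auto simp: inj_on_def A_def R_def)
  have Rtop: "c < \<top>" if "c \<in> R" for c using that fin by (auto simp: R_def)
  have prod: "(\<Prod>u\<in>#\<eta> q. f u) = (\<Prod>c\<in>R. c ^ points_in (\<eta> q) (A c))" if "q \<in> space Q" for q
  proof -
    have "\<eta> q \<in> space (config_space \<Lambda>)"
      using P that by (auto simp: poisson_process_def dest: measurable_space)
    then show ?thesis unfolding R_def A_def
      using R by (intro prod_mset_eq_prod_fibres) (auto simp: R_def space_config_space)
  qed
  have meas[measurable]: "(\<lambda>q. c ^ points_in (\<eta> q) (A c)) \<in> borel_measurable Q" for c
    by (rule measurable_compose[OF poisson_process_count(1)[OF P A]]) simp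
  show "(\<lambda>q. \<Prod>u\<in>#\<eta> q. f u) \<in> borel_measurable Q"
    by (subst measurable_cong[OF prod]) simp_all
  have ind0: "Q.indep_vars (\<lambda>_. count_space UNIV) (\<lambda>A q. points_in (\<eta> q) A) (A ` R)"
  proof -
    have "disjoint (A ` R)" using disj by (rule disjoint_family_on_disjoint_image)
    then show ?thesis using P R A unfolding poisson_process_def by blast
  qed
  have ind: "Q.indep_vars (\<lambda>_. borel) (\<lambda>F q. inv_into R A F ^ points_in (\<eta> q) F) (A ` R)"
    by (rule Q.indep_vars_compose2[OF ind0]) simp
  have int: "(\<integral>\<^sup>+u. f u \<partial>\<Lambda>) = ennreal (\<Sum>c\<in>R. enn2real c * measure \<Lambda> (A c))"
  proof -
    have "(\<integral>\<^sup>+u. f u \<partial>\<Lambda>) = (\<Sum>c\<in>R. c * emeasure \<Lambda> (A c))"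
      by (simp add: nn_integral_eq_simple_integral[OF f] simple_integral_def R_def A_def)
    also have "\<dots> = (\<Sum>c\<in>R. ennreal (enn2real c * measure \<Lambda> (A c)))"
      using Rtop by (intro sum.cong) (auto simp: L.emeasure_eq_measure ennreal_mult)
    finally show ?thesis by (simp add: sum_ennreal)
  qed
  then show "(\<integral>\<^sup>+u. f u \<partial>\<Lambda>) < \<top>" by simp
  have total: "(\<Sum>c\<in>R. measure \<Lambda> (A c)) = measure \<Lambda> (space \<Lambda>)"
  proof -
    have "space \<Lambda> = (\<Union>c\<in>R. A c)" by (auto simp: A_def R_def)
    moreover have "A ` R \<subseteq> sets \<Lambda>" using A by auto
    ultimately show ?thesis using L.finite_measure_finite_Union[OF R _ disj] by simp
  qed
  have "(\<integral>\<^sup>+q. (\<Prod>u\<in>#\<eta> q. f u) \<partial>Q) = (\<integral>\<^sup>+q. (\<Prod>c\<in>R. c ^ points_in (\<eta> q) (A c)) \<partial>Q)"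
    by (intro nn_integral_cong prod)
  also have "\<dots> = (\<integral>\<^sup>+q. (\<Prod>F\<in>A ` R. inv_into R A F ^ points_in (\<eta> q) F) \<partial>Q)"
    using inj by (simp add: prod.reindex)
  also have "\<dots> = (\<Prod>F\<in>A ` R. \<integral>\<^sup>+q. inv_into R A F ^ points_in (\<eta> q) F \<partial>Q)"
    using R by (intro Q.indep_vars_nn_integral ind) auto
  also have "\<dots> = (\<Prod>c\<in>R. \<integral>\<^sup>+q. c ^ points_in (\<eta> q) (A c) \<partial>Q)"
    using inj by (simp add: prod.reindex)
  also have "\<dots> = (\<Prod>c\<in>R. ennreal (exp ((enn2real c - 1) * measure \<Lambda> (A c))))"
  proof (intro prod.cong refl)
    fix c assume "c \<in> R"
    then have "ennreal (enn2real c) = c" using Rtop by simp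
    then show "(\<integral>\<^sup>+q. c ^ points_in (\<eta> q) (A c) \<partial>Q) =
        ennreal (exp ((enn2real c - 1) * measure \<Lambda> (A c)))"
      using poisson_count_generating_function[OF P A, of "enn2real c" c] by simp
  qed
  also have "\<dots> = ennreal (exp (\<Sum>c\<in>R. (enn2real c - 1) * measure \<Lambda> (A c)))"
    using R by (simp add: prod_ennreal exp_sum)
  also have "(\<Sum>c\<in>R. (enn2real c - 1) * measure \<Lambda> (A c)) =
      enn2real (\<integral>\<^sup>+u. f u \<partial>\<Lambda>) - measure \<Lambda> (space \<Lambda>)"
    unfolding int total[symmetric]
    by (subst enn2real_ennreal) (auto simp: sum_nonneg left_diff_distrib sum_subtractf)
  finally show "(\<integral>\<^sup>+q. (\<Prod>u\<in>#\<eta> q. f u) \<partial>Q) =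
    ennreal (exp (enn2real (\<integral>\<^sup>+u. f u \<partial>\<Lambda>) - measure \<Lambda> (space \<Lambda>)))" .
qed

text \<open>
  The case of simple functions passes to increasing limits. As \<open>f\<close> is real-valued, the products
  converge pointwise also at configurations where some factor vanishes.
\<close>

lemma poisson_product_functional:
  fixes f :: "'a \<Rightarrow> real"
  assumes P: "poisson_process Q \<eta> \<Lambda>" and f: "f \<in> borel_measurable \<Lambda>"
    and fin: "(\<integral>\<^sup>+u. ennreal (f u) \<partial>\<Lambda>) < \<top>"
  shows "(\<integral>\<^sup>+q. (\<Prod>u\<in>#\<eta> q. ennreal (f u)) \<partial>Q) =
    ennreal (exp (enn2real (\<integral>\<^sup>+u. ennreal (f u) \<partial>\<Lambda>) - measure \<Lambda> (space \<Lambda>)))"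
    and "(\<lambda>q. \<Prod>u\<in>#\<eta> q. ennreal (f u)) \<in> borel_measurable Q"
proof -
  have "(\<lambda>u. ennreal (f u)) \<in> borel_measurable \<Lambda>" using f by measurable
  from borel_measurable_implies_simple_function_sequence'[OF this]
  obtain F where F: "\<And>i. simple_function \<Lambda> (F i)" "incseq F" "\<And>i u. F i u < \<top>"
    "\<And>u. (SUP i. F i u) = ennreal (f u)" by metis
  have inc: "incseq (\<lambda>i. F i u)" for u using F(2) by (auto simp: incseq_def le_fun_def)
  have lim: "(\<lambda>i. F i u) \<longlonglongrightarrow> ennreal (f u)" for u
    using LIMSEQ_SUP[OF inc[of u]] by (simp add: F(4))
  note S = poisson_product_functional_simple[OF P F(1) F(3)]
  have lim_prod: "(\<lambda>i. \<Prod>u\<in>#\<eta> q. F i u) \<longlonglongrightarrow> (\<Prod>u\<in>#\<eta> q. ennreal (f u))" for q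
    using prod_mset_tendsto_ennreal[of "\<eta> q" F, OF lim] by simp
  show "(\<lambda>q. \<Prod>u\<in>#\<eta> q. ennreal (f u)) \<in> borel_measurable Q"
    by (rule borel_measurable_LIMSEQ_order[OF lim_prod S(3)])
  have "(\<lambda>i. \<integral>\<^sup>+q. (\<Prod>u\<in>#\<eta> q. F i u) \<partial>Q) \<longlonglongrightarrow> (\<integral>\<^sup>+q. (\<Prod>u\<in>#\<eta> q. ennreal (f u)) \<partial>Q)"
  proof (rule nn_integral_LIMSEQ)
    show "incseq (\<lambda>i q. \<Prod>u\<in>#\<eta> q. F i u)"
      using inc by (auto simp: incseq_def le_fun_def intro!: prod_mset_mono_ennreal)
  qed (rule S(3) lim_prod)+
  moreover have "(\<lambda>i. \<integral>\<^sup>+u. F i u \<partial>\<Lambda>) \<longlonglongrightarrow> (\<integral>\<^sup>+u. ennreal (f u) \<partial>\<Lambda>)"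
    using F by (intro nn_integral_LIMSEQ lim) (auto intro: borel_measurable_simple_function)
  then have "(\<lambda>i. enn2real (\<integral>\<^sup>+u. F i u \<partial>\<Lambda>)) \<longlonglongrightarrow> enn2real (\<integral>\<^sup>+u. ennreal (f u) \<partial>\<Lambda>)"
    using fin by (intro tendsto_enn2real) (auto simp: less_top)
  then have "(\<lambda>i. \<integral>\<^sup>+q. (\<Prod>u\<in>#\<eta> q. F i u) \<partial>Q) \<longlonglongrightarrow>
      ennreal (exp (enn2real (\<integral>\<^sup>+u. ennreal (f u) \<partial>\<Lambda>) - measure \<Lambda> (space \<Lambda>)))"
    unfolding S(1) by (intro tendsto_ennrealI tendsto_exp tendsto_diff tendsto_const)
  ultimately show "(\<integral>\<^sup>+q. (\<Prod>u\<in>#\<eta> q. ennreal (f u)) \<partial>Q) =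
    ennreal (exp (enn2real (\<integral>\<^sup>+u. ennreal (f u) \<partial>\<Lambda>) - measure \<Lambda> (space \<Lambda>)))"
    by (rule LIMSEQ_unique)
qed

lemma points_in_Diff:
  assumes "A \<subseteq> S"
  shows "points_in x S = points_in x A + points_in x (S - A)"
  using assms by (induction x) (auto simp: points_in_add)

text \<open>
  For an indicator of \<open>A\<close> the left-hand side is the probability that \<open>A\<close> contains one point and its
  complement none, which by independence is \<open>exp (- \<Lambda> Y) * \<Lambda> A\<close>. Hence \<open>\<eta>\<close>, weighted by the indicator of
  having exactly one point, has the mean measure \<open>exp (- \<Lambda> Y) * \<Lambda>\<close>, and Campbell's formula applies.
\<close>

lemma poisson_one_point_formula:
  fixes f :: "'a \<Rightarrow> ennreal"
  assumes P: "poisson_process Q \<eta> \<Lambda>" and f: "f \<in> borel_measurable \<Lambda>"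
  shows "(\<integral>\<^sup>+q. (if points_in (\<eta> q) (space \<Lambda>) = 1 then \<Sum>u\<in>#\<eta> q. f u else 0) \<partial>Q) =
    ennreal (exp (- measure \<Lambda> (space \<Lambda>))) * (\<integral>\<^sup>+u. f u \<partial>\<Lambda>)"
proof -
  interpret Q: prob_space Q using P by (simp add: poisson_process_def)
  interpret L: finite_measure \<Lambda> using P by (simp add: poisson_process_def)
  have \<eta>: "\<eta> \<in> Q \<rightarrow>\<^sub>M config_space \<Lambda>" using P by (simp add: poisson_process_def)
  let ?m = "measure \<Lambda> (space \<Lambda>)"
  define one :: "'b \<Rightarrow> ennreal" where "one q = indicator {1} (points_in (\<eta> q) (space \<Lambda>))" for q
  have one[measurable]: "one \<in> borel_measurable Q"
    unfolding one_def
    by (rule measurable_compose[OF poisson_process_count(1)[OF P sets.top]]) simp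
  have \<eta>': "\<eta> \<in> density Q one \<rightarrow>\<^sub>M config_space \<Lambda>" using \<eta> by simp
  have "mean_measure (density Q one) \<eta> \<Lambda> = scale_measure (ennreal (exp (- ?m))) \<Lambda>"
  proof (rule measure_eqI)
    show sets: "sets (mean_measure (density Q one) \<eta> \<Lambda>) = sets (scale_measure (ennreal (exp (- ?m))) \<Lambda>)"
      by (simp add: mean_measure_def sets.space_closed)
    fix A assume "A \<in> sets (mean_measure (density Q one) \<eta> \<Lambda>)"
    then have A: "A \<in> sets \<Lambda>" using sets by simp
    note N = poisson_process_count[OF P]
    have [measurable]: "(\<lambda>q. of_nat (points_in (\<eta> q) A) :: ennreal) \<in> borel_measurable Q"
      by (rule measurable_compose[OF N(1)[OF A]]) simp
    have mean: "emeasure (mean_measure (density Q one) \<eta> \<Lambda>) A = (\<integral>\<^sup>+q. one q * of_nat (points_in (\<eta> q) A) \<partial>Q)"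
    proof (subst emeasure_mean_measure)
      fix A assume "A \<in> sets \<Lambda>"
      then show "(\<lambda>w. points_in (\<eta> w) A) \<in> density Q one \<rightarrow>\<^sub>M count_space UNIV"
        using N(1) by simp
    qed (use A in \<open>simp_all add: nn_integral_density\<close>)
    show "emeasure (mean_measure (density Q one) \<eta> \<Lambda>) A = emeasure (scale_measure (ennreal (exp (- ?m))) \<Lambda>) A"
      \<comment> \<open>A nonempty \<open>A\<close> differs from its complement, so that the two counts below are really two
        members of an independent family.\<close>
    proof (cases "A = {}")
      case False
      define A' where "A' = space \<Lambda> - A"
      have A': "A' \<in> sets \<Lambda>" "A \<noteq> A'" using A False by (auto simp: A'_def)
      have AS: "A \<subseteq> space \<Lambda>" using A by (rule sets.sets_into_space)
      define k where "k F = (if F = A then 1 else 0 :: nat)" for F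
      have "disjoint {A, A'}" "finite {A, A'}" "{A, A'} \<subseteq> sets \<Lambda>"
        using A A'(1) by (simp_all add: disjoint_def A'_def) blast
      then have "Q.indep_vars (\<lambda>_. count_space UNIV) (\<lambda>F q. points_in (\<eta> q) F) {A, A'}"
        using P unfolding poisson_process_def by blast
      then have ind: "Q.indep_vars (\<lambda>_. borel) (\<lambda>F q. indicator {k F} (points_in (\<eta> q) F) :: ennreal) {A, A'}"
        by (rule Q.indep_vars_compose2) simp
      have prob: "(\<integral>\<^sup>+q. indicator {k F} (points_in (\<eta> q) F) \<partial>Q) =
        ennreal (measure \<Lambda> F ^ k F / fact (k F) * exp (- measure \<Lambda> F))" if "F \<in> sets \<Lambda>" for F
      proof -
        have "(\<integral>\<^sup>+q. indicator {k F} (points_in (\<eta> q) F) \<partial>Q) =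
          (\<integral>\<^sup>+q. indicator {q \<in> space Q. points_in (\<eta> q) F = k F} q \<partial>Q)"
          by (intro nn_integral_cong) (auto split: split_indicator)
        also have "\<dots> = emeasure Q {q \<in> space Q. points_in (\<eta> q) F = k F}"
          using measurable_sets[OF N(1)[OF that], of "{k F}"]
          by (intro nn_integral_indicator) (simp add: vimage_def Int_def conj_commute)
        finally show ?thesis using N(2)[OF that] by simp
      qed
      have "one q * of_nat (points_in (\<eta> q) A) = (\<Prod>F\<in>{A, A'}. indicator {k F} (points_in (\<eta> q) F))" for q
        using A'(2) points_in_Diff[OF AS, of "\<eta> q"]
        by (auto simp: one_def k_def A'_def[symmetric] split: split_indicator)
      then have "emeasure (mean_measure (density Q one) \<eta> \<Lambda>) A =
          (\<integral>\<^sup>+q. (\<Prod>F\<in>{A, A'}. indicator {k F} (points_in (\<eta> q) F)) \<partial>Q)"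
        using mean by simp
      also have "\<dots> = (\<Prod>F\<in>{A, A'}. \<integral>\<^sup>+q. indicator {k F} (points_in (\<eta> q) F) \<partial>Q)"
        by (intro Q.indep_vars_nn_integral ind) auto
      also have "\<dots> = ennreal (measure \<Lambda> A * exp (- measure \<Lambda> A)) * ennreal (exp (- measure \<Lambda> A'))"
        using A'(2) prob[OF A] prob[OF A'(1)] by (simp add: k_def)
      also have "\<dots> = ennreal (exp (- ?m)) * ennreal (measure \<Lambda> A)"
      proof -
        have "?m = measure \<Lambda> A + measure \<Lambda> A'"
          using L.finite_measure_Diff[OF sets.top A AS] by (simp add: A'_def)
        then have "exp (- ?m) = exp (- measure \<Lambda> A) * exp (- measure \<Lambda> A')"
          by (simp add: exp_add[symmetric])
        then show ?thesis by (simp add: ennreal_mult[symmetric] mult_ac)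
      qed
      finally show ?thesis by (simp add: L.emeasure_eq_measure)
    qed simp
  qed
  then have "(\<integral>\<^sup>+q. (\<Sum>u\<in>#\<eta> q. f u) \<partial>density Q one) = ennreal (exp (- ?m)) * (\<integral>\<^sup>+u. f u \<partial>\<Lambda>)"
    using f by (simp add: campbell_formula[OF \<eta>' f] nn_integral_scale_measure)
  moreover have "(\<integral>\<^sup>+q. (\<Sum>u\<in>#\<eta> q. f u) \<partial>density Q one) =
      (\<integral>\<^sup>+q. (if points_in (\<eta> q) (space \<Lambda>) = 1 then \<Sum>u\<in>#\<eta> q. f u else 0) \<partial>Q)"
    by (subst nn_integral_density[OF one measurable_sum_mset[OF \<eta> f]])
      (auto intro!: nn_integral_cong simp: one_def)
  ultimately show ?thesis by simp
qed

lemma prod_mset_ennreal: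
  assumes "\<And>u. u \<in># x \<Longrightarrow> 0 \<le> f u"
  shows "(\<Prod>u\<in>#x. ennreal (f u)) = ennreal (\<Prod>u\<in>#x. f u) \<and> 0 \<le> (\<Prod>u\<in>#x. f u)"
  using assms by (induction x) (auto simp: ennreal_mult)

lemma prod_mset_const_mult:
  fixes f :: "'a \<Rightarrow> real"
  shows "(\<Prod>u\<in>#x. k * f u) = k ^ size x * (\<Prod>u\<in>#x. f u)"
  by (induction x) (auto simp: mult_ac)

section \<open>The mean number of points of a process with repulsive density\<close>

text \<open>
  The weight \<open>f u = p {#u#} / c\<close> is \<open>\<Lambda>\<close>-integrable because \<open>p\<close> is integrable over the configurations
  with one point. The product bound on \<open>p\<close> then compares \<open>X\<close> with a Poisson process of intensity
  \<open>f d\<Lambda>\<close>, which has moments of all orders.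
\<close>

lemma finite_mean_number_of_points:
  fixes p :: "'a multiset \<Rightarrow> real"
  assumes P: "poisson_process Q \<eta> \<Lambda>"
    and X: "has_process_density M X \<Lambda> (distr Q (config_space \<Lambda>) \<eta>) p"
    and c: "0 < c"
    and p: "\<And>x. x \<in> space (config_space \<Lambda>) \<Longrightarrow> p x \<le> c * (\<Prod>u\<in>#x. p {#u#} / c)"
  shows "(\<integral>\<^sup>+w. of_nat (points_in (X w) (space \<Lambda>)) \<partial>M) < \<top>"
proof -
  have \<eta>: "\<eta> \<in> Q \<rightarrow>\<^sub>M config_space \<Lambda>" using P by (simp add: poisson_process_def)
  have XM: "X \<in> M \<rightarrow>\<^sub>M config_space \<Lambda>"
    and pm[measurable]: "p \<in> borel_measurable (config_space \<Lambda>)"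
    and p0: "\<And>x. x \<in> space (config_space \<Lambda>) \<Longrightarrow> 0 \<le> p x"
    and p1: "(\<integral>\<^sup>+x. ennreal (p x) \<partial>distr Q (config_space \<Lambda>) \<eta>) = 1"
    and D: "distr M (config_space \<Lambda>) X = density (distr Q (config_space \<Lambda>) \<eta>) (\<lambda>x. ennreal (p x))"
    using X by (auto simp: has_process_density_def)
  have [measurable]: "(\<lambda>x. of_nat (points_in x (space \<Lambda>)) :: ennreal) \<in> borel_measurable (config_space \<Lambda>)"
    by (rule measurable_compose[OF measurable_points_in[OF sets.top]]) simp
  define f where "f u = p {#u#} / c" for u
  have [measurable]: "f \<in> borel_measurable \<Lambda>"
    unfolding f_def using measurable_compose[OF measurable_singleton_mset pm] by measurable
  have f0: "0 \<le> f u" if "u \<in> space \<Lambda>" for u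
    using c p0[of "{#u#}"] that by (simp add: f_def space_config_space)
  have \<eta>s: "set_mset (\<eta> q) \<subseteq> space \<Lambda>" and \<eta>c: "\<eta> q \<in> space (config_space \<Lambda>)" if "q \<in> space Q" for q
    using measurable_space[OF \<eta> that] by (simp_all add: space_config_space)
  have fin: "(\<integral>\<^sup>+u. ennreal (f u) \<partial>\<Lambda>) < \<top>"
  proof -
    have "ennreal (exp (- measure \<Lambda> (space \<Lambda>))) * (\<integral>\<^sup>+u. ennreal (f u) \<partial>\<Lambda>) =
        (\<integral>\<^sup>+q. (if points_in (\<eta> q) (space \<Lambda>) = 1 then \<Sum>u\<in>#\<eta> q. ennreal (f u) else 0) \<partial>Q)"
      by (rule poisson_one_point_formula[OF P, symmetric]) simp
    also have "\<dots> \<le> (\<integral>\<^sup>+q. ennreal (1 / c) * ennreal (p (\<eta> q)) \<partial>Q)"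
    proof (intro nn_integral_mono)
      fix q assume q: "q \<in> space Q"
      show "(if points_in (\<eta> q) (space \<Lambda>) = 1 then \<Sum>u\<in>#\<eta> q. ennreal (f u) else 0)
          \<le> ennreal (1 / c) * ennreal (p (\<eta> q))"
      proof (cases "size (\<eta> q) = 1")
        case True
        then obtain u where "\<eta> q = {#u#}" by (metis size_1_singleton_mset)
        with c p0[OF \<eta>c[OF q]] show ?thesis
          by (simp add: f_def ennreal_mult[symmetric])
      qed (simp add: points_in_space[OF \<eta>c[OF q]])
    qed
    also have "\<dots> = ennreal (1 / c) * (\<integral>\<^sup>+x. ennreal (p x) \<partial>distr Q (config_space \<Lambda>) \<eta>)"
      using \<eta> by (simp add: nn_integral_cmult nn_integral_distr)
    also have "\<dots> < \<top>" by (simp add: p1)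
    finally show ?thesis by (auto simp: ennreal_mult_less_top)
  qed
  have "(\<integral>\<^sup>+u. ennreal (2 * f u) \<partial>\<Lambda>) = 2 * (\<integral>\<^sup>+u. ennreal (f u) \<partial>\<Lambda>)"
    using f0 by (subst nn_integral_cmult[symmetric]) (auto intro!: nn_integral_cong simp: ennreal_mult)
  then have fin2: "(\<integral>\<^sup>+u. ennreal (2 * f u) \<partial>\<Lambda>) < \<top>" using fin by (simp add: ennreal_mult_less_top)
  note product = poisson_product_functional[OF P _ fin2]
  have bound: "ennreal (p x) * of_nat (points_in x (space \<Lambda>)) \<le> ennreal c * (\<Prod>u\<in>#x. ennreal (2 * f u))"
    if x: "x \<in> space (config_space \<Lambda>)" for x
  proof -
    have fx: "0 \<le> f u" if "u \<in># x" for u using x that f0 by (auto simp: space_config_space)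
    \<comment> \<open>Bounding \<open>n\<close> by \<open>2 ^ n\<close> absorbs the number of points into the product.\<close>
    have "p x * real (size x) \<le> (c * (\<Prod>u\<in>#x. f u)) * 2 ^ size x"
    proof (rule mult_mono)
      show "p x \<le> c * (\<Prod>u\<in>#x. f u)" using p[OF x] by (simp add: f_def)
      show "real (size x) \<le> 2 ^ size x" by (rule of_nat_less_two_power[THEN less_imp_le])
    qed (use c prod_mset_ennreal[of x f] fx in auto)
    also have "\<dots> = c * (\<Prod>u\<in>#x. 2 * f u)" by (simp add: prod_mset_const_mult)
    finally have "ennreal (p x * real (size x)) \<le> ennreal (c * (\<Prod>u\<in>#x. 2 * f u))"
      by (rule ennreal_leI)
    then show ?thesis
      using p0[OF x] c prod_mset_ennreal[of x "\<lambda>u. 2 * f u"] fx points_in_space[OF x]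
      by (simp add: ennreal_mult ennreal_of_nat_eq_real_of_nat)
  qed
  have "(\<integral>\<^sup>+w. of_nat (points_in (X w) (space \<Lambda>)) \<partial>M) =
      (\<integral>\<^sup>+x. of_nat (points_in x (space \<Lambda>)) \<partial>distr M (config_space \<Lambda>) X)"
    using XM by (subst nn_integral_distr) auto
  also have "\<dots> = (\<integral>\<^sup>+q. ennreal (p (\<eta> q)) * of_nat (points_in (\<eta> q) (space \<Lambda>)) \<partial>Q)"
    unfolding D using \<eta> by (subst nn_integral_density) (auto simp: nn_integral_distr)
  also have "\<dots> \<le> (\<integral>\<^sup>+q. ennreal c * (\<Prod>u\<in>#\<eta> q. ennreal (2 * f u)) \<partial>Q)"
    by (intro nn_integral_mono bound \<eta>c)
  also have "\<dots> = ennreal c * (\<integral>\<^sup>+q. (\<Prod>u\<in>#\<eta> q. ennreal (2 * f u)) \<partial>Q)"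
    by (intro nn_integral_cmult product(2)) simp
  also have "\<dots> < \<top>"
    by (subst product(1)) (auto simp: ennreal_mult_less_top)
  finally show ?thesis .
qed

lemma sum_mset_nonneg:
  fixes f :: "'a \<Rightarrow> real"
  assumes "\<And>u. u \<in># x \<Longrightarrow> 0 \<le> f u"
  shows "0 \<le> (\<Sum>u\<in>#x. f u)"
  using assms by (induction x) auto

text \<open>
  The factor \<open>exp (a * pair_sum \<Phi> x)\<close> is at most one, and equals one if \<open>x\<close> is a single point; the
  remaining factors of \<open>p\<close> are multiplicative over the points.
\<close>

lemma gibbs_density_le_product:
  fixes p :: "'a multiset \<Rightarrow> real"
  assumes p: "\<And>x. x \<in> space (config_space E) \<Longrightarrow>
      p x = c * \<tau> ^ size x * (\<Prod>u\<in>#x. \<gamma> u) * exp (b * (\<Sum>u\<in>#x. d u) + a * pair_sum \<Phi> x)"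
    and c: "0 < c" and \<tau>: "0 < \<tau>" and a: "a \<le> 0"
    and \<gamma>: "\<And>u. u \<in> space E \<Longrightarrow> 0 \<le> \<gamma> u"
    and \<Phi>: "\<And>u v. u \<in> space E \<Longrightarrow> v \<in> space E \<Longrightarrow> 0 \<le> \<Phi> u v"
    and x: "x \<in> space (config_space E)"
  shows "p x \<le> c * (\<Prod>u\<in>#x. p {#u#} / c)"
proof -
  define f where "f u = \<tau> * \<gamma> u * exp (b * d u)" for u
  have xE: "u \<in> space E" if "u \<in># x" for u using x that by (auto simp: space_config_space)
  have f: "p {#u#} / c = f u" if "u \<in># x" for u
    using p[of "{#u#}"] xE[OF that] c by (simp add: space_config_space pair_sum_def f_def)
  have f0: "0 \<le> f u" if "u \<in># x" for u using \<tau> \<gamma>[OF xE[OF that]] by (simp add: f_def)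
  have "\<tau> ^ size x * (\<Prod>u\<in>#x. \<gamma> u) * exp (b * (\<Sum>u\<in>#x. d u)) = (\<Prod>u\<in>#x. f u)"
    by (induction x) (simp_all add: f_def exp_add distrib_left mult_ac)
  then have "p x = c * (\<Prod>u\<in>#x. f u) * exp (a * pair_sum \<Phi> x)"
    by (simp add: p[OF x] exp_add mult_ac)
  also have "\<dots> \<le> c * (\<Prod>u\<in>#x. f u)"
  proof (rule mult_left_le)
    have "0 \<le> pair_sum \<Phi> x"
      unfolding pair_sum_def using xE \<Phi> by (auto intro!: sum_mset_nonneg divide_nonneg_pos)
    then show "exp (a * pair_sum \<Phi> x) \<le> 1" using a by (simp add: mult_nonpos_nonneg)
    show "0 \<le> c * (\<Prod>u\<in>#x. f u)" using prod_mset_ennreal[of x f] f0 c by simp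
  qed
  also have "(\<Prod>u\<in>#x. f u) = (\<Prod>u\<in>#x. p {#u#} / c)"
    using f by (intro arg_cong[where f = prod_mset] image_mset_cong) simp
  finally show ?thesis .
qed

section \<open>Disintegration of a measure with a density\<close>

text \<open>
  Finite intersections of a countable basis. Measures can be compared on such a generator outside
  a single null set.
\<close>

lemma countable_Int_stable_generator_borel:
  obtains G :: "'a::second_countable_topology set set"
  where "countable G" "Int_stable G" "UNIV \<in> G" "sets borel = sigma_sets UNIV G"
proof -
  obtain U :: "'a set set" where U: "countable U" "topological_basis U"
    using ex_countable_basis by blast
  define G where "G = Inter ` {F. finite F \<and> F \<subseteq> U}"
  show ?thesis
  proof
    show "countable G" unfolding G_def
      using countable_Collect_finite_subset[OF U(1)] by (simp add: conj_commute)
    show "Int_stable G"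
    proof (rule Int_stableI)
      fix V W assume "V \<in> G" "W \<in> G"
      then obtain F H where "finite F" "F \<subseteq> U" "V = \<Inter>F" "finite H" "H \<subseteq> U" "W = \<Inter>H"
        by (auto simp: G_def)
      then show "V \<inter> W \<in> G"
        unfolding G_def by (intro image_eqI[of _ _ "F \<union> H"]) auto
    qed
    show "UNIV \<in> G" unfolding G_def by (intro image_eqI[of _ _ "{}"]) auto
    have sub: "U \<subseteq> G" unfolding G_def by (auto intro!: image_eqI[of _ _ "{_}"])
    have "G \<subseteq> sets borel"
    proof
      fix V assume "V \<in> G"
      then obtain F where F: "finite F" "F \<subseteq> U" "V = \<Inter>F" by (auto simp: G_def)
      then have "open V" using topological_basis_open[OF U(2)] by (auto intro!: open_Inter)
      then show "V \<in> sets borel" by simp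
    qed
    then have "sigma_sets UNIV G \<subseteq> sets borel"
      using sets.sigma_sets_subset[of G "borel :: 'a measure"] by simp
    moreover have "sets borel = sigma_sets UNIV U"
      by (subst borel_eq_countable_basis[OF U]) simp
    moreover have "sigma_sets UNIV U \<subseteq> sigma_sets UNIV G"
      using sub by (rule sigma_sets_mono')
    ultimately show "sets borel = sigma_sets UNIV G" by auto
  qed
qed

lemma countable_Int_stable_generator_restrict_borel:
  fixes S :: "'a::second_countable_topology set"
  assumes S: "S \<in> sets borel"
  obtains G where "countable G" "Int_stable G" "S \<in> G"
    "sets (restrict_space borel S) = sigma_sets S G"
proof -
  obtain G :: "'a set set" where G: "countable G" "Int_stable G" "UNIV \<in> G" "sets borel = sigma_sets UNIV G"
    by (rule countable_Int_stable_generator_borel)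
  show ?thesis
  proof
    show "countable ((\<inter>) S ` G)" using G(1) by simp
    show "Int_stable ((\<inter>) S ` G)"
    proof (rule Int_stableI)
      fix V W assume "V \<in> (\<inter>) S ` G" "W \<in> (\<inter>) S ` G"
      then obtain V' W' where "V' \<in> G" "W' \<in> G" "V = S \<inter> V'" "W = S \<inter> W'" by auto
      then show "V \<inter> W \<in> (\<inter>) S ` G"
        using Int_stableD[OF G(2), of V' W'] by (intro image_eqI[of _ _ "V' \<inter> W'"]) auto
    qed
    show "S \<in> (\<inter>) S ` G" using G(3) by (intro image_eqI[of _ _ UNIV]) auto
    show "sets (restrict_space borel S) = sigma_sets S ((\<inter>) S ` G)"
      using S by (simp add: sets_restrict_space G(4) sigma_sets_Int)
  qed
qed

lemma restrict_lborel_Times: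
  fixes A :: "'a::euclidean_space set" and S :: "'b::euclidean_space set"
  assumes A: "A \<in> sets borel" and S: "S \<in> sets borel"
  shows "restrict_space lborel A \<Otimes>\<^sub>M restrict_space lborel S = restrict_space lborel (A \<times> S)"
    (is "?L \<Otimes>\<^sub>M ?S = ?R")
proof (rule pair_measure_eqI)
  have AS: "A \<times> S \<in> sets borel" using A S by (rule borel_Times)
  interpret L: sigma_finite_measure ?L
    using A by (intro sigma_finite_measure_restrict_space sigma_finite_lborel) simp
  interpret S: sigma_finite_measure ?S
    using S by (intro sigma_finite_measure_restrict_space sigma_finite_lborel) simp
  show "sigma_finite_measure ?L" "sigma_finite_measure ?S" by unfold_locales
  have rect: "V \<times> W \<in> sets ?R" if "V \<in> sets ?L" "W \<in> sets ?S" for V W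
    using that A S AS by (auto simp: sets_restrict_space_iff intro: borel_Times)
  show "sets (?L \<Otimes>\<^sub>M ?S) = sets ?R"
  proof
    have "{V \<times> W |V W. V \<in> sets ?L \<and> W \<in> sets ?S} \<subseteq> sets ?R" using rect by auto
    then have "sigma_sets (A \<times> S) {V \<times> W |V W. V \<in> sets ?L \<and> W \<in> sets ?S} \<subseteq> sets ?R"
      using sets.sigma_sets_subset[of _ ?R] by (simp add: space_restrict_space)
    then show "sets (?L \<Otimes>\<^sub>M ?S) \<subseteq> sets ?R"
      by (simp add: sets_pair_measure space_restrict_space)
    show "sets ?R \<subseteq> sets (?L \<Otimes>\<^sub>M ?S)"
    proof
      fix V assume "V \<in> sets ?R"
      then have V: "V \<in> sets (borel \<Otimes>\<^sub>M borel)" "V \<subseteq> A \<times> S"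
        using AS by (auto simp: sets_restrict_space_iff borel_prod[symmetric])
      have "id \<in> ?L \<rightarrow>\<^sub>M borel" "id \<in> ?S \<rightarrow>\<^sub>M borel"
        by (auto intro!: measurable_restrict_space1)
      then have "(\<lambda>u. (id (fst u), id (snd u))) \<in> ?L \<Otimes>\<^sub>M ?S \<rightarrow>\<^sub>M borel \<Otimes>\<^sub>M borel"
        by (intro measurable_Pair measurable_compose[OF measurable_fst] measurable_compose[OF measurable_snd])
      from measurable_sets[OF this V(1)] V(2) show "V \<in> sets (?L \<Otimes>\<^sub>M ?S)"
        by (simp add: space_pair_measure space_restrict_space Int_absorb2 vimage_def)
    qed
  qed
  fix V W assume V: "V \<in> sets ?L" and W: "W \<in> sets ?S"
  then have "V \<in> sets borel" "W \<in> sets borel" "V \<subseteq> A" "W \<subseteq> S"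
    using A S by (auto simp: sets_restrict_space_iff)
  then show "emeasure ?L V * emeasure ?S W = emeasure ?R (V \<times> W)"
    using A S AS lborel.emeasure_pair_measure_Times[of V lborel W]
    by (simp add: emeasure_restrict_space lborel_prod Sigma_mono)
qed

text \<open>
  \<open>\<kappa>\<close> is the first marginal of the measure with density \<open>\<rho>\<close>, and \<open>P\<close> is a disintegration of that
  measure along \<open>\<kappa>\<close>. The conclusion is Bayes' formula for the conditional density. Finite total mass
  makes the inner integral of \<open>\<rho>\<close> finite for almost every \<open>y\<close>, which allows the division by it.
\<close>

lemma conditional_density:
  fixes \<rho> :: "'a \<times> 'b \<Rightarrow> real"
  assumes L: "sigma_finite_measure L" and S: "sigma_finite_measure S"
    and \<rho>[measurable]: "\<rho> \<in> borel_measurable (L \<Otimes>\<^sub>M S)"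
    and \<rho>0: "\<And>u. u \<in> space (L \<Otimes>\<^sub>M S) \<Longrightarrow> 0 \<le> \<rho> u"
    and fin: "(\<integral>\<^sup>+u. ennreal (\<rho> u) \<partial>(L \<Otimes>\<^sub>M S)) < \<top>"
    and \<kappa>: "sets \<kappa> = sets L"
      "\<And>A. A \<in> sets L \<Longrightarrow> emeasure \<kappa> A = (\<integral>\<^sup>+u\<in>A \<times> space S. ennreal (\<rho> u) \<partial>(L \<Otimes>\<^sub>M S))"
    and P[measurable]: "P \<in> L \<rightarrow>\<^sub>M prob_algebra S"
    and dis: "\<And>A D. A \<in> sets L \<Longrightarrow> D \<in> sets S \<Longrightarrow>
      (\<integral>\<^sup>+y\<in>A. emeasure (P y) D \<partial>\<kappa>) = (\<integral>\<^sup>+u\<in>A \<times> D. ennreal (\<rho> u) \<partial>(L \<Otimes>\<^sub>M S))"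
    and G: "countable G" "Int_stable G" "space S \<in> G" "sets S = sigma_sets (space S) G"
  shows "AE y in \<kappa>. density S (\<lambda>\<xi>. ennreal (\<rho> (y, \<xi>) / (LINT \<zeta>|S. \<rho> (y, \<zeta>)))) = P y"
proof -
  interpret L: sigma_finite_measure L by fact
  interpret S: sigma_finite_measure S by fact
  interpret pair_sigma_finite L S ..
  define h where "h y = (\<integral>\<^sup>+\<zeta>. ennreal (\<rho> (y, \<zeta>)) \<partial>S)" for y
  have h[measurable]: "h \<in> borel_measurable L" unfolding h_def by measurable
  have Fub: "(\<integral>\<^sup>+u\<in>A \<times> D. ennreal (\<rho> u) \<partial>(L \<Otimes>\<^sub>M S)) = (\<integral>\<^sup>+y\<in>A. (\<integral>\<^sup>+\<xi>\<in>D. ennreal (\<rho> (y, \<xi>)) \<partial>S) \<partial>L)"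
    if [measurable]: "A \<in> sets L" "D \<in> sets S" for A D
  proof -
    have "(\<integral>\<^sup>+\<xi>. ennreal (\<rho> (y, \<xi>)) * indicator (A \<times> D) (y, \<xi>) \<partial>S) =
        (\<integral>\<^sup>+\<xi>\<in>D. ennreal (\<rho> (y, \<xi>)) \<partial>S) * indicator A y" for y
      by (cases "y \<in> A") (simp_all add: indicator_times)
    then show ?thesis by (subst S.nn_integral_fst[symmetric]) simp_all
  qed
  have \<kappa>h: "\<kappa> = density L h"
  proof (rule measure_eqI)
    fix A assume "A \<in> sets \<kappa>"
    then have "A \<in> sets L" using \<kappa>(1) by simp
    then show "emeasure \<kappa> A = emeasure (density L h) A"
      by (simp add: \<kappa>(2) Fub emeasure_density h_def)
  qed (simp add: \<kappa>(1))
  have h_fin: "AE y in L. h y < \<top>"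
  proof -
    have "(\<integral>\<^sup>+y. h y \<partial>L) < \<top>"
      using fin S.nn_integral_fst[of "\<lambda>u. ennreal (\<rho> u)" L] by (simp add: h_def)
    then show ?thesis using nn_integral_noteq_infinite[OF h] by (auto simp: less_top)
  qed
  have GS: "D \<in> sets S" if "D \<in> G" for D using G(4) that by auto
  have "AE y in L. h y * emeasure (P y) D = (\<integral>\<^sup>+\<xi>\<in>D. ennreal (\<rho> (y, \<xi>)) \<partial>S)" if "D \<in> G" for D
  proof (rule L.density_unique2)
    have D[measurable]: "D \<in> sets S" using GS that .
    have PS[measurable]: "P \<in> L \<rightarrow>\<^sub>M subprob_algebra S" using P by (rule measurable_prob_algebraD)
    show m: "(\<lambda>y. h y * emeasure (P y) D) \<in> borel_measurable L"
      using measurable_emeasure_kernel[OF PS D] by measurable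
    show "(\<lambda>y. \<integral>\<^sup>+\<xi>\<in>D. ennreal (\<rho> (y, \<xi>)) \<partial>S) \<in> borel_measurable L" by measurable
    fix A assume A[measurable]: "A \<in> sets L"
    have "(\<integral>\<^sup>+y\<in>A. h y * emeasure (P y) D \<partial>L) = (\<integral>\<^sup>+y\<in>A. emeasure (P y) D \<partial>\<kappa>)"
      unfolding \<kappa>h using measurable_emeasure_kernel[OF PS D]
      by (subst nn_integral_density) (auto simp: mult_ac)
    then show "(\<integral>\<^sup>+y\<in>A. h y * emeasure (P y) D \<partial>L) = (\<integral>\<^sup>+y\<in>A. (\<integral>\<^sup>+\<xi>\<in>D. ennreal (\<rho> (y, \<xi>)) \<partial>S) \<partial>L)"
      using dis[OF A D] Fub[OF A D] by simp
  qed
  then have "AE y in L. \<forall>D\<in>G. h y * emeasure (P y) D = (\<integral>\<^sup>+\<xi>\<in>D. ennreal (\<rho> (y, \<xi>)) \<partial>S)"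
    using G(1) by (simp add: AE_ball_countable)
  with h_fin AE_space have "AE y in L. 0 < h y \<longrightarrow>
    density S (\<lambda>\<xi>. ennreal (\<rho> (y, \<xi>) / (LINT \<zeta>|S. \<rho> (y, \<zeta>)))) = P y"
  proof (eventually_elim, intro impI)
    fix y assume hf: "h y < \<top>" and y: "y \<in> space L" and h0: "0 < h y"
      and *: "\<forall>D\<in>G. h y * emeasure (P y) D = (\<integral>\<^sup>+\<xi>\<in>D. ennreal (\<rho> (y, \<xi>)) \<partial>S)"
    have [measurable]: "(\<lambda>\<xi>. \<rho> (y, \<xi>)) \<in> borel_measurable S" using y by measurable
    have \<rho>y: "0 \<le> \<rho> (y, \<xi>)" if "\<xi> \<in> space S" for \<xi> using \<rho>0 y that by (simp add: space_pair_measure)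
    define H where "H = (LINT \<zeta>|S. \<rho> (y, \<zeta>))"
    have "H = enn2real (h y)"
      unfolding H_def h_def by (rule integral_eq_nn_integral) (auto simp: \<rho>y)
    then have hH: "h y = ennreal H" and H: "0 < H"
      using hf h0 by (auto simp: less_top enn2real_positive_iff)
    have PS: "prob_space (P y)" "sets (P y) = sets S"
      using measurable_space[OF P y] by (auto simp: space_prob_algebra)
    have "density S (\<lambda>\<xi>. ennreal (\<rho> (y, \<xi>) / H)) = P y"
    proof (rule measure_eqI_generator_eq[OF G(2), where \<Omega> = "space S" and A = "\<lambda>_. space S"])
      show "G \<subseteq> Pow (space S)" using GS sets.sets_into_space by blast
      have eq: "emeasure (density S (\<lambda>\<xi>. ennreal (\<rho> (y, \<xi>) / H))) D = emeasure (P y) D" if "D \<in> G" for D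
      proof -
        have [measurable]: "D \<in> sets S" using GS that .
        have "emeasure (density S (\<lambda>\<xi>. ennreal (\<rho> (y, \<xi>) / H))) D =
            (\<integral>\<^sup>+\<xi>. ennreal (1 / H) * (ennreal (\<rho> (y, \<xi>)) * indicator D \<xi>) \<partial>S)"
          using H \<rho>y by (subst emeasure_density) (auto intro!: nn_integral_cong
              simp: ennreal_mult[symmetric] mult.assoc[symmetric])
        also have "\<dots> = ennreal (1 / H) * (ennreal H * emeasure (P y) D)"
          using * that hH by (subst nn_integral_cmult) auto
        also have "\<dots> = emeasure (P y) D"
          using H by (simp add: mult.assoc[symmetric] ennreal_mult[symmetric])
        finally show ?thesis .
      qed
      then show "\<And>D. D \<in> G \<Longrightarrow> emeasure (density S (\<lambda>\<xi>. ennreal (\<rho> (y, \<xi>) / H))) D = emeasure (P y) D" .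
      show "emeasure (density S (\<lambda>\<xi>. ennreal (\<rho> (y, \<xi>) / H))) (space S) \<noteq> \<infinity>" for i :: nat
        using eq[OF G(3)] PS prob_space.emeasure_space_1[OF PS(1)] sets_eq_imp_space_eq[OF PS(2)] by simp
    qed (use G PS in auto)
    then show "density S (\<lambda>\<xi>. ennreal (\<rho> (y, \<xi>) / (LINT \<zeta>|S. \<rho> (y, \<zeta>)))) = P y"
      by (simp add: H_def)
  qed
  then show ?thesis unfolding \<kappa>h by (simp add: AE_density)
qed

section \<open>The Palm mark distribution of the segment process\<close>

lemma campbell_eq_points_in:
  "campbell M X A D = (\<integral>\<^sup>+w. of_nat (points_in (X w) (A \<times> D)) \<partial>M)"
proof -
  have "(\<lambda>(y, \<xi>). indicator A y * indicator D \<xi> :: ennreal) = indicator (A \<times> D)"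
    by (auto simp: fun_eq_iff split: split_indicator)
  then show ?thesis unfolding campbell_def by (simp add: sum_mset_indicator)
qed

theorem proposition1:
  fixes B :: "(real^2) set" and b\<^sub>0 c \<tau> a b :: real
    and g :: "mark \<Rightarrow> real" and d :: "segment \<Rightarrow> real" and \<Phi> :: "segment \<Rightarrow> segment \<Rightarrow> real"
    and Q :: "'q measure" and \<eta> :: "'q \<Rightarrow> segment multiset"
    and M :: "'w measure" and X :: "'w \<Rightarrow> segment multiset"
    and p :: "segment multiset \<Rightarrow> real" and \<rho> :: "segment \<Rightarrow> real"
    and P :: "real^2 \<Rightarrow> mark measure"
  assumes "bounded B" and "B \<in> sets borel" and "b\<^sub>0 > 0"
    and "c > 0" and "\<tau> > 0" and "a \<le> 0"
    and "g \<in> borel_measurable (mark_leb b\<^sub>0)"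
    and "\<forall>\<xi> \<in> mark_set b\<^sub>0. g \<xi> \<ge> 0"
    and "(\<integral>\<^sup>+\<xi>. ennreal (g \<xi>) \<partial>mark_leb b\<^sub>0) = 1"
    and "\<forall>u \<in> B \<times> mark_set b\<^sub>0. d u \<ge> 0"
    and "\<forall>u \<in> B \<times> mark_set b\<^sub>0. \<forall>v \<in> B \<times> mark_set b\<^sub>0. \<Phi> u v \<ge> 0"
    and "poisson_process Q \<eta> (reference_measure B b\<^sub>0)"
    and "prob_space M"
    and "\<forall>x \<in> space (config_space (segment_leb B b\<^sub>0)).
           p x = c * \<tau> ^ size x * (\<Prod>(y, r, \<phi>)\<in>#x. g (r, \<phi>))
                   * exp (b * (\<Sum>u\<in>#x. d u) + a * pair_sum \<Phi> x)"
    and "hereditary (segment_leb B b\<^sub>0) p"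
    and "has_process_density M X (segment_leb B b\<^sub>0)
           (distr Q (config_space (segment_leb B b\<^sub>0)) \<eta>) p"
    and "intensity_function M X B b\<^sub>0 \<rho>"
    and "palm_mark_distribution M X B b\<^sub>0 P"
  shows "AE y in centre_measure M X B. AE \<xi> in mark_leb b\<^sub>0.
           mark_density b\<^sub>0 P y \<xi> = ennreal (\<rho> (y, \<xi>) / (LINT \<zeta>|mark_leb b\<^sub>0. \<rho> (y, \<zeta>)))"
proof -
  define S where "S = mark_leb b\<^sub>0"
  define L where "L = restrict_space lborel B"
  define \<Lambda> where "\<Lambda> = reference_measure B b\<^sub>0"
  note B = assms(2)
  have MS: "mark_set b\<^sub>0 \<in> sets borel" unfolding mark_set_def by (intro borel_Times) auto
  have LS: "L \<Otimes>\<^sub>M S = segment_leb B b\<^sub>0"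
    unfolding L_def S_def mark_leb_def segment_leb_def by (rule restrict_lborel_Times[OF B MS])
  have spS: "space S = mark_set b\<^sub>0" and spL: "space L = B"
    by (simp_all add: S_def mark_leb_def L_def space_restrict_space)
  have spY: "space (segment_leb B b\<^sub>0) = B \<times> mark_set b\<^sub>0"
    by (simp add: segment_leb_def space_restrict_space)
  have L: "sigma_finite_measure L" and S: "sigma_finite_measure S"
    unfolding L_def S_def mark_leb_def
    using B MS by (auto intro!: sigma_finite_measure_restrict_space sigma_finite_lborel)
  have setsL: "sets L = sets (restrict_space borel B)"
    unfolding L_def by (rule sets_restrict_space_cong) simp
  have sets\<Lambda>: "sets \<Lambda> = sets (segment_leb B b\<^sub>0)"
    by (simp add: \<Lambda>_def reference_measure_def)
  have conf: "config_space \<Lambda> = config_space (segment_leb B b\<^sub>0)" by (rule config_space_cong[OF sets\<Lambda>])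
  have sp\<Lambda>: "space \<Lambda> = B \<times> mark_set b\<^sub>0" using sets_eq_imp_space_eq[OF sets\<Lambda>] spY by simp
  have \<rho>: "\<rho> \<in> borel_measurable (L \<Otimes>\<^sub>M S)"
    and \<rho>0: "\<And>u. u \<in> space (L \<Otimes>\<^sub>M S) \<Longrightarrow> 0 \<le> \<rho> u"
    and int: "\<And>V. V \<in> sets (L \<Otimes>\<^sub>M S) \<Longrightarrow>
      (\<integral>\<^sup>+w. of_nat (points_in (X w) V) \<partial>M) = (\<integral>\<^sup>+u\<in>V. ennreal (\<rho> u) \<partial>(L \<Otimes>\<^sub>M S))"
    using assms(17) unfolding intensity_function_def LS by blast+
  have XM: "X \<in> M \<rightarrow>\<^sub>M config_space (segment_leb B b\<^sub>0)"
    using assms(16) by (simp add: has_process_density_def)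
  have "(\<integral>\<^sup>+w. of_nat (points_in (X w) (space \<Lambda>)) \<partial>M) < \<top>"
  proof (rule finite_mean_number_of_points)
    show "poisson_process Q \<eta> \<Lambda>" unfolding \<Lambda>_def by fact
    show "has_process_density M X \<Lambda> (distr Q (config_space \<Lambda>) \<eta>) p"
      using assms(16) by (simp add: has_process_density_def conf)
    show "0 < c" by fact
    fix x assume x: "x \<in> space (config_space \<Lambda>)"
    show "p x \<le> c * (\<Prod>u\<in>#x. p {#u#} / c)"
    proof (rule gibbs_density_le_product[OF _ assms(4) assms(5) assms(6) _ _ x])
      show "p x = c * \<tau> ^ size x * (\<Prod>u\<in>#x. g (snd u))
          * exp (b * (\<Sum>u\<in>#x. d u) + a * pair_sum \<Phi> x)"
        if "x \<in> space (config_space \<Lambda>)" for x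
        using assms(14) that by (simp add: conf case_prod_unfold)
    qed (use assms(8,11) sp\<Lambda> in auto)
  qed
  moreover have "(\<integral>\<^sup>+u. ennreal (\<rho> u) \<partial>(L \<Otimes>\<^sub>M S)) = (\<integral>\<^sup>+u\<in>space (L \<Otimes>\<^sub>M S). ennreal (\<rho> u) \<partial>(L \<Otimes>\<^sub>M S))"
    by (intro nn_integral_cong) simp
  ultimately have fin: "(\<integral>\<^sup>+u. ennreal (\<rho> u) \<partial>(L \<Otimes>\<^sub>M S)) < \<top>"
    using int[OF sets.top] by (simp add: LS spY sp\<Lambda>)
  have sets\<kappa>: "sets (centre_measure M X B) = sets L"
    unfolding centre_measure_def mean_measure_def setsL by (rule sets.sets_measure_of_eq)
  have \<kappa>: "emeasure (centre_measure M X B) A = (\<integral>\<^sup>+u\<in>A \<times> space S. ennreal (\<rho> u) \<partial>(L \<Otimes>\<^sub>M S))"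
    if A: "A \<in> sets L" for A
  proof -
    have "points_in (image_mset fst (X w)) A = points_in (X w) (A \<times> space S)" if "w \<in> space M" for w
    proof -
      have "set_mset (X w) \<subseteq> B \<times> mark_set b\<^sub>0"
        using measurable_space[OF XM that] by (simp add: space_config_space spY)
      then show ?thesis
        unfolding points_in_def filter_mset_image_mset size_image_mset
        by (intro arg_cong[where f = size] filter_mset_cong) (auto simp: spS)
    qed
    then show ?thesis
      using A emeasure_centre_measure[OF XM B, of A] int[of "A \<times> space S"]
      by (simp add: setsL cong: nn_integral_cong)
  qed
  have P: "P \<in> L \<rightarrow>\<^sub>M prob_algebra S"
    using assms(18) unfolding palm_mark_distribution_def S_def measurable_cong_sets[OF setsL refl] by blast
  have dis: "(\<integral>\<^sup>+y\<in>A. emeasure (P y) D \<partial>centre_measure M X B) =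
      (\<integral>\<^sup>+u\<in>A \<times> D. ennreal (\<rho> u) \<partial>(L \<Otimes>\<^sub>M S))" if A: "A \<in> sets L" and D: "D \<in> sets S" for A D
  proof -
    have "(\<integral>\<^sup>+y\<in>A. emeasure (P y) D \<partial>centre_measure M X B) = campbell M X A D"
      using assms(18) A D by (simp add: palm_mark_distribution_def S_def setsL)
    also have "\<dots> = (\<integral>\<^sup>+u\<in>A \<times> D. ennreal (\<rho> u) \<partial>(L \<Otimes>\<^sub>M S))"
      unfolding campbell_eq_points_in using A D by (intro int) simp
    finally show ?thesis .
  qed
  obtain G where G: "countable G" "Int_stable G" "mark_set b\<^sub>0 \<in> G"
    "sets (restrict_space borel (mark_set b\<^sub>0)) = sigma_sets (mark_set b\<^sub>0) G"
    by (rule countable_Int_stable_generator_restrict_borel[OF MS])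
  have setsS: "sets S = sigma_sets (space S) G"
    using G(4) sets_restrict_space_cong[of lborel borel "mark_set b\<^sub>0"]
    by (simp add: S_def mark_leb_def space_restrict_space)
  have "AE y in centre_measure M X B.
      density S (\<lambda>\<xi>. ennreal (\<rho> (y, \<xi>) / (LINT \<zeta>|S. \<rho> (y, \<zeta>)))) = P y"
    by (rule conditional_density[OF L S \<rho> \<rho>0 fin sets\<kappa> \<kappa> P dis G(1,2) _ setsS]) (simp_all add: spS G(3))
  moreover have "AE y in centre_measure M X B. y \<in> space L"
    using AE_space[of "centre_measure M X B"] sets_eq_imp_space_eq[OF sets\<kappa>] by simp
  ultimately show ?thesis
  proof eventually_elim
    case (elim y)
    have "(\<lambda>\<xi>. \<rho> (y, \<xi>)) \<in> borel_measurable S"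
      using \<rho> elim(2) by measurable
    then have "(\<lambda>\<xi>. ennreal (\<rho> (y, \<xi>) / (LINT \<zeta>|S. \<rho> (y, \<zeta>)))) \<in> borel_measurable S"
      by measurable
    from sigma_finite_measure.RN_deriv_unique[OF S this elim(1)] show ?case
      unfolding mark_density_def S_def by eventually_elim simp
  qed
qed

end
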